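(* Let $h\ge 2$ be an integer, let $\varepsilon>0$ and $c>0$, and let $P$ be a finite poset. If $P$ is $\varepsilon$-far from being $C_h$-free, then a random subset of $\left\lceil\frac{4\log(h)+4c+1}{2\varepsilon}\right\rceil$ elements of $P$ chosen independently and uniformly at random contains a copy of $C_h$ with probability at least $1-e^{-c}$.
   Context: A poset is a set with an anti-reflexive, transitive relation $\prec$; it is regarded as a digraph whose edges are the pairs $(x,y)$ with $x\prec y$. $|P|$ is the number of elements of $P$. $C_h$ is the chain with $h$ elements; a poset is $C_h$-free if it contains no chain with $h$ elements, and a subset of $P$ contains a copy of $C_h$ if it contains $h$ elements forming a chain in $P$. $P$ is $\varepsilon$-far from being $C_h$-free if no poset $P'$ on the same set of elements whose edge set differs from that of $P$ in at most $\varepsilon|P|^2$ edges is $C_h$-free. $\log$ is the natural logarithm. The random subset is the set of elements obtained from the stated number of independent, uniformly distributed draws from $P$ (an element may be drawn more than once). *)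

theory Defs
  imports "HOL-Probability.Probability"
begin

definition poset_on :: "'a set \<Rightarrow> ('a \<times> 'a) set \<Rightarrow> bool" where
  "poset_on P E \<longleftrightarrow> E \<subseteq> P \<times> P \<and> irrefl E \<and> trans E"

definition contains_chain :: "('a \<times> 'a) set \<Rightarrow> nat \<Rightarrow> 'a set \<Rightarrow> bool" where
  "contains_chain E h S \<longleftrightarrow> (\<exists>C. C \<subseteq> S \<and> finite C \<and> card C = h \<and> total_on C E)"

abbreviation chain_free :: "nat \<Rightarrow> 'a set \<Rightarrow> ('a \<times> 'a) set \<Rightarrow> bool" where
  "chain_free h P E \<equiv> \<not> contains_chain E h P"

definition far_from_chain_free :: "real \<Rightarrow> nat \<Rightarrow> 'a set \<Rightarrow> ('a \<times> 'a) set \<Rightarrow> bool" where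
  "far_from_chain_free \<epsilon> h P E \<longleftrightarrow>
     \<not> (\<exists>E'. poset_on P E' \<and> real (card (sym_diff E E')) \<le> \<epsilon> * (real (card P))\<^sup>2
            \<and> chain_free h P E')"

(* m independent uniform draws from P (finite and nonempty), with repetition, as a list. *)
abbreviation uniform_sample_pmf :: "nat \<Rightarrow> 'a set \<Rightarrow> 'a list pmf" where
  "uniform_sample_pmf m P \<equiv> replicate_pmf m (pmf_of_set P)"

end

theory Submission
  imports Defs
begin

text \<open>
  Let \<open>n\<close> be the number of elements of \<open>P\<close>, \<open>q\<close> the sample size, and \<open>m\<close> the least integer
  with \<open>m \<ge> \<epsilon> n / 2\<close>.  Define a decreasing sequence of levels: level \<open>0\<close> is \<open>P\<close>, and an element
  is in level \<open>k + 1\<close> when at least \<open>m\<close> elements of level \<open>k\<close> lie above it.  Two facts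
  about the levels give the theorem.

  \<^item> If level \<open>h - 1\<close> had fewer than \<open>m\<close> elements, \<open>P\<close> could be made \<open>C\<^sub>h\<close>-free cheaply
    (\<open>level_drop_edges\<close>).  Remove all edges that start in level \<open>h - 1\<close>, at most
    \<open>(\<epsilon> n / 2) n\<close> of them, and all edges whose upper end lies in every level that contains the
    lower end.  An element \<open>x\<close> outside level \<open>h - 1\<close> loses fewer than \<open>m\<close> edges in the second way:
    if \<open>k\<close> is its last level, the lost edges lead to elements of level \<open>k\<close>, and \<open>x\<close> is
    not in level \<open>k + 1\<close>.  So at most \<open>\<epsilon> n\<^sup>2\<close> edges go, and along the remaining edges the
    number of levels among the first \<open>h - 1\<close> that contain an element strictly decreases.

  \<^item> If level \<open>h - 1\<close> has at least \<open>m\<close> elements, sampling finds a chain by climbing: take the first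
    sampled element of level \<open>h - 1\<close> in a linear extension of the order, then the first sampled
    element of level \<open>h - 2\<close> above it, and so on.  At each of the \<open>h\<close> stages there are at least \<open>m\<close>
    elements, any of which lets the search continue.  They lie above the current element, so they
    come later in the linear extension, and the search so far has not ruled out any of them.

  The delicate point is that one wants the failure probability of each stage to be at most
  \<open>(1 - m/n)\<^sup>q\<close>, although up to \<open>h - 1\<close> of the draws have been spent on the elements found so far.
  The spent draws are exactly compensated by the elements that the search has ruled out, which
  make all other elements likelier.  To see this, count the sample lists that avoid certain elements
  and hit \<open>r\<close> others.  Their number is an \<open>r\<close>-th finite difference of the function \<open>s \<mapsto> s\<^sup>q\<close>, and as
  the search runs over the possible positions of its next hit, the bounds telescope
  (\<open>card_stuck_lists_le\<close>).  Hence the sample misses \<open>C\<^sub>h\<close> with probability at most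
  \<open>h (1 - m/n)\<^sup>q \<le> h exp (- \<epsilon> q / 2) \<le> exp (- c)\<close>.
\<close>

section \<open>Sample lists that cover a given set\<close>

lemma replicate_pmf_of_set:
  fixes A :: "'a set"
  assumes "finite A" "A \<noteq> {}"
  shows "replicate_pmf q (pmf_of_set A) = pmf_of_set {xs. set xs \<subseteq> A \<and> length xs = q}"
proof (induction q)
  case 0
  have "{xs. set xs \<subseteq> A \<and> length xs = 0} = {[]}"
    by auto
  then show ?case
    by (simp add: pmf_of_set_singleton)
next
  case (Suc q)
  let ?L = "{xs. set xs \<subseteq> A \<and> length xs = q}"
  have L: "finite ?L" "?L \<noteq> {}"
    using assms finite_lists_length_eq[of A q]
    by (auto intro!: exI[of _ "replicate q (SOME x. x \<in> A)"] simp: some_in_eq)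
  have "replicate_pmf (Suc q) (pmf_of_set A)
      = map_pmf (\<lambda>(x, xs). x # xs) (pair_pmf (pmf_of_set A) (pmf_of_set ?L))"
    by (simp add: Suc pair_pmf_def map_bind_pmf)
  also have "pair_pmf (pmf_of_set A) (pmf_of_set ?L) = pmf_of_set (A \<times> ?L)"
  proof (rule pmf_eqI)
    fix z :: "'a \<times> 'a list"
    have "indicator (A \<times> ?L) z = (indicator A (fst z) * indicator ?L (snd z) :: real)"
      by (cases z) (simp add: indicator_times)
    then show "pmf (pair_pmf (pmf_of_set A) (pmf_of_set ?L)) z = pmf (pmf_of_set (A \<times> ?L)) z"
      using assms L pmf_pair[of "pmf_of_set A" "pmf_of_set ?L" "fst z" "snd z"]
      by (simp add: card_cartesian_product)
  qed
  also have "map_pmf (\<lambda>(x, xs). x # xs) \<dots> = pmf_of_set ((\<lambda>(x, xs). x # xs) ` (A \<times> ?L))"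
    using assms L by (intro map_pmf_of_set_inj) (auto simp: inj_on_def)
  also have "(\<lambda>(x, xs). x # xs) ` (A \<times> ?L) = {xs. set xs \<subseteq> A \<and> length xs = Suc q}"
    by (auto simp: image_iff length_Suc_conv)
  finally show ?case .
qed

text \<open>
  The \<open>r\<close>-th forward difference of \<open>x \<mapsto> x\<^sup>q\<close> at \<open>s\<close>, which is the number of words of length \<open>q\<close>
  over \<open>s + r\<close> letters in which each of \<open>r\<close> chosen letters occurs.  The difference form
  makes the recursion that drives the telescoping sum hold by definition.
\<close>

primrec covering_count :: "nat \<Rightarrow> nat \<Rightarrow> nat \<Rightarrow> int" where
  "covering_count q s 0 = int s ^ q"
| "covering_count q s (Suc r) = covering_count q (Suc s) r - covering_count q s r"

definition covering_lists :: "nat \<Rightarrow> 'a set \<Rightarrow> 'a set \<Rightarrow> 'a list set" where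
  "covering_lists q F Z = {xs. length xs = q \<and> Z \<subseteq> set xs \<and> set xs \<subseteq> F \<union> Z}"

lemma finite_covering_lists:
  assumes "finite F" "finite Z"
  shows "finite (covering_lists q F Z)"
  by (rule finite_subset[OF _ finite_lists_length_eq[of "F \<union> Z" q]])
     (use assms in \<open>auto simp: covering_lists_def\<close>)

text \<open>
  A list over \<open>F\<close>, \<open>z\<close> and \<open>Z\<close> that covers \<open>Z\<close> either misses \<open>z\<close> or covers it too.  This is the
  difference recursion.
\<close>

lemma card_covering_lists:
  assumes "finite Z" "finite F" "F \<inter> Z = {}"
  shows "int (card (covering_lists q F Z)) = covering_count q (card F) (card Z)"
  using assms
proof (induction Z arbitrary: F rule: finite_induct)
  case empty
  have "covering_lists q F {} = {xs. set xs \<subseteq> F \<and> length xs = q}"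
    by (auto simp: covering_lists_def)
  then show ?case
    using empty by (simp add: card_lists_length_eq)
next
  case (insert z Z)
  have split: "covering_lists q (insert z F) Z = covering_lists q F Z \<union> covering_lists q F (insert z Z)"
    using insert.prems insert.hyps by (auto simp: covering_lists_def)
  have disj: "covering_lists q F Z \<inter> covering_lists q F (insert z Z) = {}"
    using insert.prems insert.hyps by (auto simp: covering_lists_def)
  have "card (covering_lists q (insert z F) Z)
      = card (covering_lists q F Z) + card (covering_lists q F (insert z Z))"
    unfolding split using insert.prems insert.hyps
    by (intro card_Un_disjoint disj finite_covering_lists) auto
  moreover have "int (card (covering_lists q (insert z F) Z)) = covering_count q (Suc (card F)) (card Z)"
    using insert.IH[of "insert z F"] insert.prems insert.hyps by auto
  moreover have "int (card (covering_lists q F Z)) = covering_count q (card F) (card Z)"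
    using insert.IH[of F] insert.prems by auto
  ultimately show ?case
    using insert.hyps by simp
qed

lemma covering_count_nonneg: "0 \<le> covering_count q s r"
  using card_covering_lists[of "{s..<s + r}" "{..<s}" q] by (auto simp: disjoint_iff)

text \<open>
  The increment in \<open>s\<close> is the next difference, which is itself a cardinality.
\<close>

lemma covering_count_mono:
  assumes "s \<le> t"
  shows "covering_count q s r \<le> covering_count q t r"
  using assms
proof (induction rule: dec_induct)
  case (step t)
  then show ?case
    using covering_count_nonneg[of q t "Suc r"] by simp
qed simp

section \<open>Climbing through a sample\<close>

text \<open>
  \<open>climbs E S k N\<close> says that \<open>S\<close> contains \<open>k + 1\<close> elements, each above the one before, of which
  the first is in \<open>N\<close>.  The recursive form matches a search that fixes the lowest element first.
\<close>

primrec climbs :: "('a \<times> 'a) set \<Rightarrow> 'a set \<Rightarrow> nat \<Rightarrow> 'a set \<Rightarrow> bool" where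
  "climbs E S 0 N \<longleftrightarrow> S \<inter> N \<noteq> {}"
| "climbs E S (Suc k) N \<longleftrightarrow> (\<exists>z\<in>S \<inter> N. climbs E S k (E `` {z}))"

lemma climbs_mono:
  assumes "climbs E S k N" "N \<subseteq> N'"
  shows "climbs E S k N'"
  using assms by (cases k) auto

lemma climbs_imp_chain:
  assumes "trans E" "irrefl E" "climbs E S k N"
  shows "\<exists>C. C \<subseteq> S \<inter> (N \<union> E `` N) \<and> finite C \<and> card C = Suc k \<and> total_on C E"
  using assms(3)
proof (induction k arbitrary: N)
  case 0
  then obtain z where "z \<in> S \<inter> N" by auto
  then show ?case
    by (intro exI[of _ "{z}"]) auto
next
  case (Suc k)
  then obtain z where z: "z \<in> S \<inter> N" "climbs E S k (E `` {z})" by auto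
  from Suc.IH[OF z(2)] obtain C where C:
    "C \<subseteq> S \<inter> (E `` {z} \<union> E `` (E `` {z}))" "finite C" "card C = Suc k" "total_on C E"
    by auto
  have above: "(z, y) \<in> E" if "y \<in> C" for y
    using that C(1) assms(1) by (auto dest: transD)
  have "z \<notin> C"
    using above assms(2) by (auto simp: irrefl_def)
  then show ?case
    using C z(1) above
    by (intro exI[of _ "insert z C"]) (auto simp: total_on_def)
qed

text \<open>
  From an element of level \<open>k\<close> one can climb \<open>k\<close> further steps, each time with at least \<open>m\<close> choices
  that allow all the remaining steps.
\<close>

primrec level :: "('a \<times> 'a) set \<Rightarrow> 'a set \<Rightarrow> nat \<Rightarrow> nat \<Rightarrow> 'a set" where
  "level E P m 0 = P"
| "level E P m (Suc k) = {x \<in> P. m \<le> card (E `` {x} \<inter> level E P m k)}"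

lemma level_subset: "level E P m k \<subseteq> P"
  by (cases k) auto

lemma level_Suc_subset:
  assumes "finite P"
  shows "level E P m (Suc k) \<subseteq> level E P m k"
proof (induction k)
  case (Suc k)
  have "finite (E `` {x} \<inter> level E P m k)" for x
    using finite_subset[OF level_subset assms] by blast
  then have "card (E `` {x} \<inter> level E P m (Suc k)) \<le> card (E `` {x} \<inter> level E P m k)" for x
    by (intro card_mono) (use Suc in blast)+
  then show ?case
    by (auto simp del: level.simps(2) simp: level.simps(2)[of E P m "Suc k"] level.simps(2)[of E P m k]
        intro: order_trans)
qed simp

lemma level_antimono:
  assumes "finite P" "j \<le> k"
  shows "level E P m k \<subseteq> level E P m j"
  using assms(2) level_Suc_subset[OF assms(1)] by (rule lift_Suc_antimono_le[rotated])

text \<open>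
  The state of a search through a linear extension: the elements of \<open>Z\<close> are those found in the sample,
  \<open>F\<close> holds the elements not yet inspected, and everything else is known to be absent.
\<close>

definition stuck_lists ::
  "('a \<times> 'a) set \<Rightarrow> nat \<Rightarrow> 'a set \<Rightarrow> 'a set \<Rightarrow> nat \<Rightarrow> 'a set \<Rightarrow> 'a list set" where
  "stuck_lists E q F Z k N = {xs \<in> covering_lists q F Z. \<not> climbs E (set xs) k N}"

lemma card_stuck_lists_0:
  assumes "finite F" "finite Z" "F \<inter> Z = {}" "N \<subseteq> F"
  shows "int (card (stuck_lists E q F Z 0 N)) = covering_count q (card F - card N) (card Z)"
proof -
  have "stuck_lists E q F Z 0 N = covering_lists q (F - N) Z"
    using assms(3,4) by (auto simp: stuck_lists_def covering_lists_def)
  then show ?thesis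
    using card_covering_lists[of Z "F - N" q] assms
    by (auto simp: card_Diff_subset finite_subset)
qed

text \<open>
  The \<open>k + 1\<close> summands bound the failures at the \<open>k + 1\<close> stages of the climb.  In the current stage
  failure means that all of \<open>N\<close> is missed.  In a later stage \<open>m\<close> or more elements are missed.
  The set \<open>N\<close> may be smaller than \<open>m\<close> because the induction removes its elements one by one.

  Take a minimal element \<open>z\<close> of \<open>N\<close>.  If the sample misses \<open>z\<close>, the search goes on in \<open>N - {z}\<close>.
  If it contains \<open>z\<close>, the search goes on among the elements of level \<open>k\<close> above \<open>z\<close>, with one stage
  less and one more element found.  By minimality \<open>z\<close> is not above another element of \<open>N\<close>, so
  everything above \<open>N - {z}\<close> is still uninspected.  The later-stage terms of the two cases are values of \<open>covering_count\<close> at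
  \<open>(s, r)\<close> and \<open>(s, r + 1)\<close>, and they add up to the value at \<open>(s + 1, r)\<close>, which
  is exactly the bound before \<open>z\<close> was inspected.
\<close>

lemma card_stuck_lists_le:
  assumes poset: "poset_on P E" and "finite P"
    and "finite F" "finite Z" "F \<inter> Z = {}" "F \<subseteq> P"
    and "N \<subseteq> F" "N \<subseteq> level E P m k" "E `` N \<subseteq> F"
  shows "int (card (stuck_lists E q F Z k N))
    \<le> covering_count q (card F - card N) (card Z) + int k * covering_count q (card F - m) (card Z)"
  using assms(3-)
proof (induction k arbitrary: F Z N)
  case 0
  then show ?case
    using card_stuck_lists_0[of F Z N E q] by simp
next
  case (Suc k)
  have E: "E \<subseteq> P \<times> P" "irrefl E" "trans E"
    using poset by (auto simp: poset_on_def)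
  have wf: "wf E"
    using E \<open>finite P\<close> by (intro finite_acyclic_wf)
      (auto intro: finite_subset simp: acyclic_irrefl trancl_id)
  note outer = Suc.IH
  have "finite N"
    using Suc.prems finite_subset by blast
  then show ?case
    using Suc.prems
  proof (induction "card N" arbitrary: F Z N)
    case 0
    then have "N = {}" by simp
    have "card (stuck_lists E q F Z (Suc k) N) \<le> card (covering_lists q F Z)"
      using 0 by (intro card_mono finite_covering_lists) (auto simp: stuck_lists_def)
    then show ?case
      using card_covering_lists[of Z F q] 0 covering_count_nonneg[of q "card F - m" "card Z"]
      by (simp add: \<open>N = {}\<close> add_increasing2)
  next
    case (Suc l)
    then have "N \<noteq> {}" by auto
    then obtain z where z: "z \<in> N" "\<And>y. (y, z) \<in> E \<Longrightarrow> y \<notin> N"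
      using wfE_min'[OF wf] by metis
    define F' where "F' = F - {z}"
    define A where "A = E `` {z} \<inter> level E P m k"
    have zF: "z \<in> F" "z \<notin> Z" "z \<notin> E `` {z}"
      using z Suc.prems E by (auto simp: irrefl_def)
    have F': "finite F'" "F' \<subseteq> P"
      using Suc.prems by (auto simp: F'_def)
    have cF: "card F = Suc (card F')"
      using card_Suc_Diff1[of F z] Suc.prems zF by (simp add: F'_def)
    have AF': "A \<subseteq> F'" "E `` A \<subseteq> F'"
    proof -
      have "E `` {z} \<subseteq> F'"
        using z Suc.prems zF by (auto simp: F'_def)
      moreover have "E `` A \<subseteq> E `` {z}"
        using E by (auto simp: A_def dest: transD)
      ultimately show "A \<subseteq> F'" "E `` A \<subseteq> F'" by (auto simp: A_def)
    qed
    \<comment> \<open>At least \<open>m\<close> choices remain above \<open>z\<close>, because \<open>z\<close> is in level \<open>k + 1\<close>.\<close>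
    have mA: "m \<le> card A"
      using z Suc.prems by (auto simp: A_def)
    have cA: "card A \<le> card F'"
      using AF' F' by (intro card_mono)
    have sub: "stuck_lists E q F Z (Suc k) N
      \<subseteq> stuck_lists E q F' Z (Suc k) (N - {z}) \<union> stuck_lists E q F' (insert z Z) k A"
    proof
      fix xs assume xs: "xs \<in> stuck_lists E q F Z (Suc k) N"
      show "xs \<in> stuck_lists E q F' Z (Suc k) (N - {z}) \<union> stuck_lists E q F' (insert z Z) k A"
      proof (cases "z \<in> set xs")
        case True
        then have "\<not> climbs E (set xs) k (E `` {z})"
          using xs z by (auto simp: stuck_lists_def)
        then have "\<not> climbs E (set xs) k A"
          using climbs_mono[of E "set xs" k A "E `` {z}"] by (auto simp: A_def)
        then show ?thesis
          using xs True by (auto simp: stuck_lists_def covering_lists_def F'_def)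
      next
        case False
        then show ?thesis
          using xs by (auto simp: stuck_lists_def covering_lists_def F'_def)
      qed
    qed
    have fin: "finite (stuck_lists E q F' Y j B)" if "finite Y" for Y j B
      using finite_covering_lists[of F' Y q] F' that by (auto simp: stuck_lists_def)
    have "card (stuck_lists E q F Z (Suc k) N)
      \<le> card (stuck_lists E q F' Z (Suc k) (N - {z})) + card (stuck_lists E q F' (insert z Z) k A)"
      using card_mono[OF _ sub] fin Suc.prems card_Un_le order_trans
      by (metis finite_UnI finite_insert)
    moreover have "int (card (stuck_lists E q F' Z (Suc k) (N - {z})))
      \<le> covering_count q (card F - card N) (card Z)
        + int (Suc k) * covering_count q (card F' - m) (card Z)"
    proof -
      have "E `` (N - {z}) \<subseteq> F'"
        using Suc.prems z by (auto simp: F'_def)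
      moreover have "card N = Suc l" "card (N - {z}) = l"
        using Suc.hyps z Suc.prems by auto
      moreover have "F' \<inter> Z = {}" "N - {z} \<subseteq> F'" "N - {z} \<subseteq> level E P m (Suc k)" "finite (N - {z})"
        using Suc.prems by (auto simp: F'_def)
      ultimately show ?thesis
        using Suc.hyps(1)[of "N - {z}" F' Z] F' cF Suc.prems by simp
    qed
    moreover have "int (card (stuck_lists E q F' (insert z Z) k A))
      \<le> int (Suc k) * covering_count q (card F' - m) (Suc (card Z))"
    proof -
      have "int (card (stuck_lists E q F' (insert z Z) k A))
        \<le> covering_count q (card F' - card A) (Suc (card Z))
          + int k * covering_count q (card F' - m) (Suc (card Z))"
      proof -
        have "F' \<inter> insert z Z = {}" "A \<subseteq> level E P m k"
          using Suc.prems by (auto simp: F'_def A_def)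
        then show ?thesis
          using outer[of F' "insert z Z" A] F' AF' Suc.prems zF by simp
      qed
      moreover have "covering_count q (card F' - card A) (Suc (card Z))
        \<le> covering_count q (card F' - m) (Suc (card Z))"
        using mA by (intro covering_count_mono) auto
      ultimately show ?thesis by (simp add: algebra_simps)
    qed
    \<comment> \<open>The difference recursion applies because \<open>m \<le> card F'\<close>, so that the natural subtraction is exact.\<close>
    moreover have "covering_count q (card F - m) (card Z)
      = covering_count q (card F' - m) (card Z) + covering_count q (card F' - m) (Suc (card Z))"
      using mA cA cF by (simp add: Suc_diff_le)
    ultimately show ?case
      by (simp add: algebra_simps)
  qed
qed

lemma card_stuck_lists_level_le:
  assumes "poset_on P E" "finite P" "m \<le> card (level E P m k)"
  shows "card (stuck_lists E q P {} k (level E P m k)) \<le> Suc k * (card P - m) ^ q"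
proof -
  have "int (card (stuck_lists E q P {} k (level E P m k)))
    \<le> covering_count q (card P - card (level E P m k)) 0 + int k * covering_count q (card P - m) 0"
    using card_stuck_lists_le[of P E P "{}" "level E P m k" m k q] assms level_subset[of E P m k]
    by (auto simp: poset_on_def)
  also have "covering_count q (card P - card (level E P m k)) 0 \<le> covering_count q (card P - m) 0"
    using assms(3) by (intro covering_count_mono) auto
  finally have "int (card (stuck_lists E q P {} k (level E P m k))) \<le> int (Suc k * (card P - m) ^ q)"
    by (simp add: algebra_simps)
  then show ?thesis by (simp only: of_nat_le_iff)
qed

section \<open>Destroying all long chains\<close>

text \<open>
  The edges along which some level is left, except those starting in level \<open>K\<close>.  Elements of
  level \<open>K\<close> can be the upper end of no such edge, so they become isolated.
\<close>

definition level_drop_edges :: "('a \<times> 'a) set \<Rightarrow> 'a set \<Rightarrow> nat \<Rightarrow> nat \<Rightarrow> ('a \<times> 'a) set" where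
  "level_drop_edges E P m K =
     {(x, y) \<in> E. x \<notin> level E P m K \<and> (\<exists>k. x \<in> level E P m k \<and> y \<notin> level E P m k)}"

text \<open>
  As the levels are nested, a level that is left on the second edge of a path contains the start of
  the first edge as well.  This gives transitivity.
\<close>

lemma poset_on_level_drop_edges:
  assumes "poset_on P E" "finite P"
  shows "poset_on P (level_drop_edges E P m K)"
proof -
  have E: "E \<subseteq> P \<times> P" "irrefl E" "trans E"
    using assms by (auto simp: poset_on_def)
  have "trans (level_drop_edges E P m K)"
  proof (rule transI)
    fix x y z
    assume xy: "(x, y) \<in> level_drop_edges E P m K" and yz: "(y, z) \<in> level_drop_edges E P m K"
    obtain j where j: "x \<in> level E P m j" "y \<notin> level E P m j"
      using xy by (auto simp: level_drop_edges_def)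
    obtain k where k: "y \<in> level E P m k" "z \<notin> level E P m k"
      using yz by (auto simp: level_drop_edges_def)
    have "k \<le> j"
      using level_antimono[OF assms(2), of j k E m] j k by (meson nat_le_linear subsetD)
    then have "x \<in> level E P m k"
      using level_antimono[OF assms(2)] j by blast
    then show "(x, z) \<in> level_drop_edges E P m K"
      using xy yz k E by (auto simp: level_drop_edges_def dest: transD)
  qed
  moreover have "level_drop_edges E P m K \<subseteq> E"
    by (auto simp: level_drop_edges_def)
  ultimately show ?thesis
    using E by (auto simp: poset_on_def irrefl_def)
qed

text \<open>
  The number of levels below \<open>K\<close> that contain an element is between \<open>1\<close> and \<open>K\<close>, level \<open>0\<close> being
  everything, and it drops along each edge that is kept.
\<close>

lemma chain_free_level_drop_edges:
  assumes "finite P" "K > 0"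
  shows "chain_free (Suc K) P (level_drop_edges E P m K)"
proof
  assume "contains_chain (level_drop_edges E P m K) (Suc K) P"
  then obtain C where C: "C \<subseteq> P" "finite C" "card C = Suc K"
      "total_on C (level_drop_edges E P m K)"
    by (auto simp: contains_chain_def)
  define height where "height x = card {k. k < K \<and> x \<in> level E P m k}" for x
  have less: "height y < height x" if edge: "(x, y) \<in> level_drop_edges E P m K" for x y
  proof -
    obtain k where k: "x \<in> level E P m k" "y \<notin> level E P m k" and x: "x \<notin> level E P m K"
      using edge by (auto simp: level_drop_edges_def)
    have kK: "k < K"
      using level_antimono[OF assms(1), of K k E m] k x by (meson not_le subsetD)
    have "{j. j < K \<and> y \<in> level E P m j} \<subset> {j. j < K \<and> x \<in> level E P m j}"
    proof -
      have "j \<le> k" if "y \<in> level E P m j" for j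
        using level_antimono[OF assms(1), of k j E m] that k by (meson nat_le_linear subsetD)
      then have "x \<in> level E P m j" if "y \<in> level E P m j" for j
        using level_antimono[OF assms(1), of j k E m] that k by blast
      then show ?thesis
        using k kK by blast
    qed
    then show ?thesis
      unfolding height_def by (intro psubset_card_mono) auto
  qed
  have "inj_on height C"
    using C(4) less by (metis inj_onI less_irrefl total_on_def)
  moreover have "height ` C \<subseteq> {1..K}"
  proof
    fix n assume "n \<in> height ` C"
    then obtain x where x: "x \<in> C" "n = height x" by auto
    have "0 \<in> {k. k < K \<and> x \<in> level E P m k}"
      using x C assms(2) by auto
    then have "height x > 0"
      unfolding height_def by (subst card_gt_0_iff) auto
    moreover have "height x \<le> card {..<K}"
      unfolding height_def by (intro card_mono) auto
    ultimately show "n \<in> {1..K}" using x by simp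
  qed
  ultimately have "card C \<le> card {1..K}"
    by (metis card_inj_on_le finite_atLeastAtMost)
  then show False
    using C by simp
qed

text \<open>
  The edges removed at \<open>x\<close> lead into the last level \<open>k\<close> that contains \<open>x\<close>.  As \<open>x\<close> is not in level
  \<open>k + 1\<close>, there are fewer than \<open>m\<close> of them.
\<close>

lemma card_same_level_le:
  assumes "finite P" "E \<subseteq> P \<times> P" "x \<in> P" "x \<notin> level E P m K"
  shows "card {y. (x, y) \<in> E - level_drop_edges E P m K} < m"
proof -
  obtain k where k: "x \<in> level E P m k" "x \<notin> level E P m (Suc k)"
  proof (rule ccontr)
    assume "\<not> thesis"
    then have "x \<in> level E P m k" for k
      using that assms(3) by (induction k) (auto simp del: level.simps(2))
    then show False
      using assms(4) by blast
  qed
  have "{y. (x, y) \<in> E - level_drop_edges E P m K} \<subseteq> E `` {x} \<inter> level E P m k"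
    using k(1) assms(4) by (auto simp: level_drop_edges_def)
  then have "card {y. (x, y) \<in> E - level_drop_edges E P m K} \<le> card (E `` {x} \<inter> level E P m k)"
    using finite_subset[OF level_subset[of E P m k] assms(1)] by (intro card_mono) auto
  then show ?thesis
    using k(2) assms(3) by simp
qed

text \<open>
  One contribution of \<open>\<delta> n\<close> comes from the fewer than \<open>m\<close> elements of level \<open>K\<close>, which lose all edges
  going up, and the other from the remaining elements, which lose fewer than \<open>m\<close> each.
\<close>

lemma card_removed_edges_le:
  assumes "finite P" "E \<subseteq> P \<times> P"
    and small: "\<And>i. i < m \<Longrightarrow> real i \<le> \<delta>" and "\<delta> \<ge> 0"
    and "card (level E P m K) < m"
  shows "real (card (E - level_drop_edges E P m K)) \<le> 2 * \<delta> * card P"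
proof -
  let ?T = "level E P m K"
  let ?R = "\<lambda>x. {y. (x, y) \<in> E - level_drop_edges E P m K}"
  have RP: "?R x \<subseteq> P" for x
    using assms(2) by auto
  then have finR: "finite (?R x)" for x
    using assms(1) finite_subset by blast
  have TP: "?T \<subseteq> P"
    by (rule level_subset)
  have "E - level_drop_edges E P m K = Sigma P ?R"
    using assms(2) by auto
  moreover have "card (Sigma P ?R) = (\<Sum>x\<in>P. card (?R x))"
    using assms(1) finR by (intro card_SigmaI) blast+
  ultimately have "real (card (E - level_drop_edges E P m K)) = (\<Sum>x\<in>P. real (card (?R x)))"
    by (simp only: of_nat_sum)
  also have "\<dots> \<le> (\<Sum>x\<in>P. (if x \<in> ?T then real (card P) else 0) + \<delta>)"
  proof (rule sum_mono)
    fix x assume x: "x \<in> P"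
    show "real (card (?R x)) \<le> (if x \<in> ?T then real (card P) else 0) + \<delta>"
    proof (cases "x \<in> ?T")
      case True
      have "card (?R x) \<le> card P"
        using RP assms(1) by (intro card_mono)
      then show ?thesis
        using True \<open>\<delta> \<ge> 0\<close> by simp
    next
      case False
      then show ?thesis
        using small card_same_level_le[OF assms(1,2) x False] by simp
    qed
  qed
  also have "\<dots> = real (card ?T) * card P + card P * \<delta>"
    using assms(1) TP by (simp add: sum.distrib sum.If_cases Int_absorb1)
  also have "\<dots> \<le> \<delta> * card P + card P * \<delta>"
    using small[OF assms(5)] by (intro add_right_mono mult_right_mono) auto
  finally show ?thesis by simp
qed

section \<open>The sampling bound\<close>

theorem theorem1p4:
  fixes P :: "'a set" and E :: "('a \<times> 'a) set" and h :: nat and \<epsilon> c :: real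
  assumes "h \<ge> 2" and "\<epsilon> > 0" and "c > 0"
    and "finite P" and "poset_on P E"
    and "far_from_chain_free \<epsilon> h P E"
  shows "measure_pmf.prob
           (uniform_sample_pmf (nat \<lceil>(4 * ln (real h) + 4 * c + 1) / (2 * \<epsilon>)\<rceil>) P)
           {xs. contains_chain E h (set xs)}
         \<ge> 1 - exp (- c)"
proof -
  define n where "n = card P"
  define m where "m = nat \<lceil>\<epsilon> * n / 2\<rceil>"
  define X where "X = 4 * ln (real h) + 4 * c + 1"
  define q where "q = nat \<lceil>X / (2 * \<epsilon>)\<rceil>"
  obtain K where K: "h = Suc K" "K > 0"
    using \<open>h \<ge> 2\<close> by (cases h) auto
  have EP: "E \<subseteq> P \<times> P" "irrefl E" "trans E"
    using assms by (auto simp: poset_on_def)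
  have m_le: "m \<le> card (level E P m K)"
  proof (rule ccontr)
    assume "\<not> m \<le> card (level E P m K)"
    then have "real (card (E - level_drop_edges E P m K)) \<le> 2 * (\<epsilon> * n / 2) * card P"
      using \<open>\<epsilon> > 0\<close> \<open>finite P\<close> EP
      by (intro card_removed_edges_le) (auto simp: m_def less_ceiling_iff zless_nat_eq_int_zless)
    moreover have "sym_diff E (level_drop_edges E P m K) = E - level_drop_edges E P m K"
      by (auto simp: level_drop_edges_def)
    ultimately show False
      using assms(4-6) poset_on_level_drop_edges[of P E m K]
        chain_free_level_drop_edges[of P K E m] K
      by (auto simp: far_from_chain_free_def n_def power2_eq_square mult.assoc)
  qed
  have "P \<noteq> {}"
  proof
    assume "P = {}"
    then have "poset_on P {}" "chain_free h P {}"
      using K by (auto simp: poset_on_def irrefl_def contains_chain_def)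
    then show False
      using assms(6) EP \<open>P = {}\<close> by (auto simp: far_from_chain_free_def)
  qed
  then have "n > 0"
    using \<open>finite P\<close> by (simp add: n_def card_gt_0_iff)
  have mn: "m \<le> n"
    using m_le card_mono[OF \<open>finite P\<close> level_subset[of E P m K]] by (simp add: n_def)
  let ?L = "{xs. set xs \<subseteq> P \<and> length xs = q}"
  let ?M = "measure_pmf.prob (uniform_sample_pmf q P)"
  have L: "finite ?L" "card ?L = n ^ q"
    using \<open>finite P\<close> by (auto simp: finite_lists_length_eq card_lists_length_eq n_def)
  then have "?L \<noteq> {}"
    using \<open>n > 0\<close> by (metis card.empty power_not_zero less_numeral_extra(3))
  have "?L \<inter> - {xs. contains_chain E h (set xs)} \<subseteq> stuck_lists E q P {} K (level E P m K)"
  proof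
    fix xs assume xs: "xs \<in> ?L \<inter> - {xs. contains_chain E h (set xs)}"
    have "\<not> climbs E (set xs) K (level E P m K)"
    proof
      assume "climbs E (set xs) K (level E P m K)"
      from climbs_imp_chain[OF EP(3,2) this] have "contains_chain E h (set xs)"
        unfolding contains_chain_def K(1) by (elim exE conjE) auto
      then show False
        using xs by simp
    qed
    then show "xs \<in> stuck_lists E q P {} K (level E P m K)"
      using xs by (simp add: stuck_lists_def covering_lists_def)
  qed
  then have "card (?L \<inter> - {xs. contains_chain E h (set xs)})
      \<le> card (stuck_lists E q P {} K (level E P m K))"
    using finite_covering_lists[of P "{}" q] \<open>finite P\<close>
    by (intro card_mono) (auto simp: stuck_lists_def)
  also have "\<dots> \<le> h * (n - m) ^ q"
    using card_stuck_lists_level_le[OF assms(5,4) m_le] by (simp add: K n_def)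
  finally have bad: "real (card (?L \<inter> - {xs. contains_chain E h (set xs)})) \<le> real (h * (n - m) ^ q)"
    by (rule of_nat_mono)
  have "?M (- {xs. contains_chain E h (set xs)})
      = card (?L \<inter> - {xs. contains_chain E h (set xs)}) / n ^ q"
    unfolding replicate_pmf_of_set[OF \<open>finite P\<close> \<open>P \<noteq> {}\<close>]
    by (subst measure_pmf_of_set[OF \<open>?L \<noteq> {}\<close> L(1)]) (simp only: L(2))
  also have "\<dots> \<le> real (h * (n - m) ^ q) / n ^ q"
    by (intro divide_right_mono bad) auto
  also have "\<dots> = h * (real n - m) ^ q / n ^ q"
    using mn by simp
  also have "\<dots> = h * ((real n - m) / n) ^ q"
    by (simp add: power_divide)
  also have "\<dots> = h * (1 - m / n) ^ q"
    using \<open>n > 0\<close> by (simp add: diff_divide_distrib)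
  also have "\<dots> \<le> h * exp (- (\<epsilon> / 2)) ^ q"
  proof -
    have "\<epsilon> * n / 2 \<le> m"
      by (simp add: m_def real_nat_ceiling_ge)
    then have "\<epsilon> / 2 \<le> m / n"
      using \<open>n > 0\<close> by (simp add: field_simps)
    then have "1 - m / n \<le> exp (- (\<epsilon> / 2))"
      using exp_ge_add_one_self[of "- (\<epsilon> / 2)"] by linarith
    then show ?thesis
      using mn \<open>n > 0\<close> by (intro mult_left_mono power_mono) auto
  qed
  also have "\<dots> = h * exp (- (\<epsilon> / 2 * q))"
    by (simp add: exp_of_nat_mult[symmetric] mult.commute)
  also have "\<dots> \<le> h * exp (- (X / 4))"
  proof -
    have "X / (2 * \<epsilon>) \<le> q"
      by (simp add: q_def real_nat_ceiling_ge)
    then have "X / 4 \<le> \<epsilon> / 2 * q"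
      using \<open>\<epsilon> > 0\<close> by (simp add: field_simps)
    then show ?thesis by (simp add: mult_left_mono)
  qed
  also have "\<dots> = exp (ln h) * exp (- (X / 4))"
    using \<open>h \<ge> 2\<close> by simp
  also have "\<dots> = exp (ln h + - (X / 4))"
    by (rule exp_add[symmetric])
  also have "\<dots> \<le> exp (- c)"
    unfolding exp_le_cancel_iff X_def by argo
  finally have "?M (- {xs. contains_chain E h (set xs)}) \<le> exp (- c)" .
  then have "?M {xs. contains_chain E h (set xs)} \<ge> 1 - exp (- c)"
    using measure_pmf.prob_compl[of "{xs. contains_chain E h (set xs)}" "uniform_sample_pmf q P"]
    unfolding Compl_eq_Diff_UNIV by simp
  then show ?thesis
    unfolding q_def X_def .
qed

end
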